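(* Let $\mathbf{X}\sim\mathcal{N}(\mathbf{0}_n,\mathbf{I}_n)$. Then for every $i\in\{1,\dots,n\}$, $$\left|\mathbb{E}[X_{(i)}]-\Phi^{-1}\left(\frac{i}{n+1}\right)\right|\le\sqrt{\frac{\pi}{2}}\sqrt{\frac{2}{i}+\frac{2}{n+1-i}+\left|\frac1i-\frac{1}{2(n+1-i)}\right|^2},$$ and $$\left|\mathsf{Var}(\vec{\mathbf{X}})-\left(n-\sum_{i=1}^n\left(\Phi^{-1}\left(\frac{i}{n+1}\right)\right)^2\right)\right|\le 2\sqrt{18(n+1)\frac{3\pi}{2}\left(2\log(n)+\frac1n+1\right)}+\frac{3\pi}{2}\left(2\log(n)+\frac1n+1\right).$$
   Context: $\vec{\mathbf{X}}$ is $\mathbf{X}$ with entries sorted in ascending order and $X_{(i)}$ is its $i$-th entry (the $i$-th order statistic). $\mathsf{Var}(\vec{\mathbf{X}})=\mathbb{E}\left[\|\vec{\mathbf{X}}-\mathbb{E}[\vec{\mathbf{X}}]\|^2\right]$. $\Phi^{-1}$ is the quantile function (inverse CDF) of the standard normal distribution; $\log$ is the natural logarithm. *)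

theory Defs
  imports "HOL-Probability.Probability"
begin

definition gauss_vec :: "nat \<Rightarrow> (nat \<Rightarrow> real) measure" where
  "gauss_vec n = PiM {..<n} (\<lambda>_. std_normal_distribution)"

definition order_stat :: "nat \<Rightarrow> nat \<Rightarrow> (nat \<Rightarrow> real) \<Rightarrow> real" where
  "order_stat n i x = sort (map x [0..<n]) ! (i - 1)"

definition Phi :: "real \<Rightarrow> real" where
  "Phi t = measure std_normal_distribution {..t}"

definition Phi_inv :: "real \<Rightarrow> real" where
  "Phi_inv p = (THE t. Phi t = p)"

text \<open>Var of the sorted vector: E ||sort X - E[sort X]||^2.\<close>
definition sorted_var :: "nat \<Rightarrow> real" where
  "sorted_var n = (\<Sum>i=1..n. integral\<^sup>L (gauss_vec n)
      (\<lambda>x. (order_stat n i x - integral\<^sup>L (gauss_vec n) (order_stat n i))\<^sup>2))"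

end

theory Submission
  imports Defs
begin

text \<open>
  Put \<open>a = i\<close>, \<open>b = n + 1 - i\<close>, \<open>q = \<Phi>\<^sup>-\<^sup>1 (i / (n + 1))\<close> and \<open>c = \<surd>(\<pi> / 2)\<close>. Since \<open>\<Phi> (1 - \<Phi>) \<le> c \<phi>\<close>, the
  quantile function is \<open>c\<close>-Lipschitz in the log-odds, so \<open>(x - q)\<^sup>2 \<le> c\<^sup>2 (ln r)\<^sup>2 \<le> c\<^sup>2 (r + 1 / r - 2)\<close>
  where \<open>r\<close> is the ratio of the odds \<open>\<Phi> / (1 - \<Phi>)\<close> at \<open>x\<close> and at \<open>q\<close>. The \<open>i\<close>-th order statistic has
  density \<open>i (n choose i) \<Phi>\<^bsup>i-1\<^esup> (1 - \<Phi>)\<^bsup>n-i\<^esup> \<phi>\<close>; multiplying it by the odds gives a multiple of the density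
  of rank \<open>i + 1\<close>, so the expectations of \<open>r\<close> and \<open>1 / r\<close> are explicit and the squared bias is at most
  \<open>c\<^sup>2 (1 / (a - 1) + 1 / (b - 1)) \<le> c\<^sup>2 (2 / a + 2 / b)\<close> for \<open>a, b \<ge> 2\<close>. For \<open>b = 1\<close> the bias is at most \<open>c\<close>,
  and reflection covers \<open>a = 1\<close>.

  Sorting preserves the sum of squares, so the variance of the sorted vector is \<open>n\<close> minus the sum of
  the squared means, and the second bound follows from the first one by Cauchy-Schwarz and
  \<open>1 + 1/2 + \<dots> + 1/n \<le> 1 + ln n\<close>.
\<close>

abbreviation (input) "\<phi> \<equiv> std_normal_density"

subsection \<open>The standard normal distribution function\<close>

lemma Phi_eq_cdf: "Phi = cdf std_normal_distribution"
  by (simp add: fun_eq_iff Phi_def cdf_def)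

lemma std_normal_density_even: "\<phi> (- x) = \<phi> x"
  by (simp add: std_normal_density_def)

lemma DERIV_std_normal_density: "DERIV \<phi> x :> - x * \<phi> x"
  unfolding std_normal_density_def
  by (auto intro!: derivative_eq_intros simp: field_simps)

lemma std_normal_density_tendsto_0: "(\<phi> \<longlongrightarrow> 0) at_top"
proof -
  have "filterlim (\<lambda>x::real. - (x\<^sup>2) / 2) at_bot at_top"
    unfolding filterlim_uminus_at_bot
    by (simp add: filterlim_pow_at_top filterlim_ident filterlim_tendsto_pos_mult_at_top[of "\<lambda>_. 1/2" "1/2", simplified])
  then have "((\<lambda>x::real. exp (- x\<^sup>2 / 2)) \<longlongrightarrow> 0) at_top"
    by (rule filterlim_compose[OF exp_at_bot])
  then show ?thesis
    unfolding std_normal_density_def by (intro tendsto_mult_right_zero)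
qed

text \<open>Near \<open>x\<close>, \<open>Phi\<close> is a constant plus the integral of the
  continuous density from \<open>x - 1\<close>, so the fundamental theorem of calculus applies.
  Since \<open>x\<close> is interior to the window, the derivative within it is the full
  derivative.\<close>

lemma DERIV_Phi: "DERIV Phi x :> \<phi> x"
proof -
  interpret real_distribution std_normal_distribution by (rule real_dist_normal_dist)
  let ?a = "x - 1" and ?b = "x + 1"
  have cont: "continuous_on {?a..?b} \<phi>"
    by (intro DERIV_continuous_on[where D="\<lambda>x. - x * \<phi> x"] DERIV_subset[OF DERIV_std_normal_density]) auto
  have eq: "Phi y = Phi ?a + integral {?a..y} \<phi>" if "y \<in> {?a..?b}" for y
  proof (cases "y = ?a")
    case False
    with that have y: "?a < y" by simp
    have "Phi y - Phi ?a = measure std_normal_distribution {?a<..y}"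
      unfolding Phi_eq_cdf using y by (rule cdf_diff_eq)
    also have "\<dots> = (\<integral>x. indicator {?a<..y} x * \<phi> x \<partial>lborel)"
      unfolding measure_def
      by (subst emeasure_density) (auto simp: integral_eq_nn_integral intro!: arg_cong[where f=enn2real] nn_integral_cong split: split_indicator)
    also have "\<dots> = (\<integral>x. indicator {?a..y} x *\<^sub>R \<phi> x \<partial>lborel)"
      by (intro integral_cong_AE) (auto intro!: AE_I[where N="{?a}"] split: split_indicator)
    also have "\<dots> = integral {?a..y} \<phi>"
      using set_borel_integral_eq_integral(2)[of "{?a..y}" \<phi>]
        borel_integrable_atLeastAtMost'[OF continuous_on_subset[OF cont, of "{?a..y}"]] that
      by (simp add: set_lebesgue_integral_def set_integrable_def)
    finally show ?thesis by simp
  qed simp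
  have "((\<lambda>u. Phi ?a + integral {?a..u} \<phi>) has_real_derivative \<phi> x) (at x within {?a..?b})"
    by (auto intro!: derivative_eq_intros integral_has_real_derivative[OF cont])
  then have "(Phi has_real_derivative \<phi> x) (at x within {?a..?b})"
    by (rule has_field_derivative_transform_within[OF _ zero_less_one]) (simp_all only: eq[symmetric], simp)
  moreover have "at x within {?a..?b} = at x"
    by (intro at_within_interior) auto
  ultimately show ?thesis by simp
qed

lemma continuous_on_Phi [continuous_intros]: "continuous_on A Phi"
  by (rule DERIV_continuous_on[OF has_field_derivative_at_within[OF DERIV_Phi]])

lemma borel_measurable_Phi [measurable]: "Phi \<in> borel_measurable borel"
  by (rule borel_measurable_continuous_onI) (rule continuous_on_Phi)

lemma strict_mono_Phi: "x < y \<Longrightarrow> Phi x < Phi y"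
  by (erule DERIV_pos_imp_increasing) (metis DERIV_Phi normal_density_pos zero_less_one)

lemma Phi_tendsto_1: "(Phi \<longlongrightarrow> 1) at_top"
proof -
  interpret real_distribution std_normal_distribution by (rule real_dist_normal_dist)
  show ?thesis unfolding Phi_eq_cdf by (rule cdf_lim_at_top_prob)
qed

lemma Phi_tendsto_0: "(Phi \<longlongrightarrow> 0) at_bot"
proof -
  interpret real_distribution std_normal_distribution by (rule real_dist_normal_dist)
  show ?thesis unfolding Phi_eq_cdf by (rule cdf_lim_at_bot)
qed

lemma Phi_pos: "0 < Phi x" and Phi_less_1: "Phi x < 1"
proof -
  interpret real_distribution std_normal_distribution by (rule real_dist_normal_dist)
  have "0 \<le> Phi (x - 1)" "Phi (x + 1) \<le> 1"
    unfolding Phi_eq_cdf by (rule cdf_nonneg cdf_bounded_prob)+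
  with strict_mono_Phi[of "x - 1" x] strict_mono_Phi[of x "x + 1"]
  show "0 < Phi x" "Phi x < 1" by auto
qed

text \<open>The density is even, so \<open>Phi (- x) + Phi x\<close> has derivative 0; the constant
  is its limit 1 at infinity.\<close>

lemma Phi_uminus: "Phi (- x) = 1 - Phi x"
proof -
  have "DERIV (\<lambda>x. Phi (- x) + Phi x) x :> 0" for x
    using DERIV_add[OF DERIV_chain2[OF DERIV_Phi DERIV_minus[OF DERIV_ident]] DERIV_Phi]
    by (simp add: std_normal_density_even)
  then have "Phi (- y) + Phi y = Phi (- x) + Phi x" for y
    by (intro DERIV_isconst_all[where f="\<lambda>x. Phi (- x) + Phi x"] allI)
  then have c: "(\<lambda>y. Phi (- y) + Phi y) = (\<lambda>y. Phi (- x) + Phi x)"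
    by (rule ext)
  have "((\<lambda>y. Phi (- y) + Phi y) \<longlongrightarrow> 0 + 1) at_top"
    by (intro tendsto_add Phi_tendsto_1 filterlim_compose[OF Phi_tendsto_0 filterlim_uminus_at_bot_at_top])
  then have "((\<lambda>y::real. Phi (- x) + Phi x) \<longlongrightarrow> 1) at_top"
    unfolding c by simp
  then show ?thesis by (simp add: tendsto_const_iff)
qed

lemma Phi_inv_eqI: "Phi x = p \<Longrightarrow> Phi_inv p = x"
  unfolding Phi_inv_def
  by (rule the_equality) (metis strict_mono_Phi linorder_neq_iff)+

text \<open>The limits 0 and 1 together with the intermediate value theorem give a preimage of
  \<open>p\<close>, and strict monotonicity makes it the one that \<open>THE\<close>
  selects.\<close>

lemma Phi_Phi_inv:
  assumes "0 < p" "p < 1"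
  shows "Phi (Phi_inv p) = p"
proof -
  obtain a where a: "Phi a < p"
    using order_tendstoD(2)[OF Phi_tendsto_0 assms(1)] eventually_happens[of _ at_bot] by fastforce
  obtain b where b: "p < Phi b"
    using order_tendstoD(1)[OF Phi_tendsto_1 assms(2)] eventually_happens[of _ at_top] by fastforce
  have "a \<le> b" using a b strict_mono_Phi[of b a] by force
  with a b obtain x where "Phi x = p"
    using IVT'[of Phi a p b] continuous_on_Phi by auto
  then show ?thesis using Phi_inv_eqI by auto
qed

lemma Phi_inv_one_minus:
  assumes "0 < p" "p < 1"
  shows "Phi_inv (1 - p) = - Phi_inv p"
  using assms by (intro Phi_inv_eqI) (simp add: Phi_uminus Phi_Phi_inv)

text \<open>The value \<open>f x\<close> dominates every later value of \<open>f\<close>, hence of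
  the minorant \<open>l\<close>, whose limit is 0. The separate \<open>l\<close> serves functions
  \<open>f\<close> whose own limit has not been computed.\<close>

lemma nonneg_of_antitone_tendsto_0:
  fixes f l :: "real \<Rightarrow> real"
  assumes "\<And>y. x \<le> y \<Longrightarrow> f y \<le> f x" and "\<And>y. x \<le> y \<Longrightarrow> l y \<le> f y" and "(l \<longlongrightarrow> 0) at_top"
  shows "0 \<le> f x"
proof (rule tendsto_upperbound[OF assms(3)])
  show "\<forall>\<^sub>F y in at_top. l y \<le> f x"
    using eventually_ge_at_top[of x] by eventually_elim (use assms in force)
qed simp

text \<open>At \<open>x = 0\<close> this gives 1/2, so the constant \<open>sqrt (pi / 2)\<close> is
  the one that makes the tail bound below an equality at 0.\<close>

lemma sqrt_half_pi_density: "sqrt (pi / 2) * \<phi> x = exp (- x\<^sup>2 / 2) / 2"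
proof -
  have "sqrt (pi / 2) / sqrt (2 * pi) = 1 / 2"
    by (simp add: real_sqrt_divide[symmetric] real_sqrt_mult[symmetric])
      (simp add: real_sqrt_divide)
  then show ?thesis by (simp add: std_normal_density_def)
qed

text \<open>The difference of the two sides vanishes at \<open>0\<close> and at infinity, and it first increases and then decreases.\<close>

lemma gaussian_tail_le:
  assumes "0 \<le> x"
  shows "1 - Phi x \<le> sqrt (pi / 2) * \<phi> x"
proof -
  define c where "c = sqrt (pi / 2)"
  define h where "h x = c * \<phi> x - (1 - Phi x)" for x
  have c: "c > 0" by (simp add: c_def)
  have D: "DERIV h x :> \<phi> x * (1 - c * x)" for x
    unfolding h_def
    by (auto intro!: derivative_eq_intros DERIV_Phi DERIV_std_normal_density simp: algebra_simps)
  have "0 \<le> h x"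
  \<comment> \<open>By \<open>D\<close> the derivative of \<open>h\<close> changes sign at
    \<open>1 / c\<close>.\<close>
  proof (cases "x \<le> 1 / c")
    case True
    have "h 0 = 0"
      using Phi_uminus[of 0] sqrt_half_pi_density[of 0] by (simp add: h_def c_def)
    moreover have "h 0 \<le> h x"
    proof (rule DERIV_nonneg_imp_nondecreasing[OF assms])
      fix y assume y: "0 \<le> y" "y \<le> x"
      then have "c * y \<le> 1" using True c by (simp add: field_simps) (metis mult.commute order_trans mult_left_mono less_imp_le)
      then show "\<exists>d. DERIV h y :> d \<and> 0 \<le> d" using D[of y] by (intro exI conjI) auto
    qed
    ultimately show ?thesis by simp
  next
    case False
    show ?thesis
    proof (rule nonneg_of_antitone_tendsto_0[where f=h and l=h])
      fix y assume xy: "x \<le> y"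
      show "h y \<le> h x"
      proof (rule DERIV_nonpos_imp_nonincreasing[OF xy])
        fix z assume "x \<le> z" "z \<le> y"
        then have "1 \<le> c * z" using False c by (simp add: field_simps) (smt (verit) mult.commute mult_left_mono)
        then show "\<exists>d. DERIV h z :> d \<and> d \<le> 0" using D[of z]
          by (intro exI conjI) (auto intro!: mult_nonneg_nonpos)
      qed
    next
      have "((\<lambda>x. c * \<phi> x - (1 - Phi x)) \<longlongrightarrow> c * 0 - (1 - 1)) at_top"
        by (intro tendsto_intros Phi_tendsto_1 std_normal_density_tendsto_0)
      then show "(h \<longlongrightarrow> 0) at_top" by (simp add: h_def[abs_def])
    qed simp
  qed
  then show ?thesis by (simp add: h_def c_def)
qed

text \<open>For \<open>x \<ge> 0\<close> drop the factor \<open>Phi x \<le> 1\<close> and use the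
  tail bound; both sides are even in \<open>x\<close>.\<close>

lemma Phi_mult_le: "Phi x * (1 - Phi x) \<le> sqrt (pi / 2) * \<phi> x"
proof -
  have *: "Phi x * (1 - Phi x) \<le> sqrt (pi / 2) * \<phi> x" if "0 \<le> x" for x
  proof -
    have "Phi x * (1 - Phi x) \<le> 1 * (1 - Phi x)"
      using Phi_less_1[of x] by (intro mult_right_mono) auto
    with gaussian_tail_le[OF that] show ?thesis by simp
  qed
  show ?thesis
    using *[of x] *[of "- x"] by (cases "0 \<le> x") (auto simp: Phi_uminus std_normal_density_even mult.commute)
qed

text \<open>The difference \<open>g\<close> of the two sides has derivative
  \<open>(1 - Phi x) - c * \<phi> x\<close>, which is nonpositive by the tail bound, and
  \<open>g\<close> lies above \<open>- \<phi>\<close>, which tends to 0.\<close>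

lemma gaussian_mills_lower:
  assumes "0 \<le> x"
  shows "\<phi> x \<le> (x + sqrt (pi / 2)) * (1 - Phi x)"
proof -
  define c where "c = sqrt (pi / 2)"
  define g where "g x = (x + c) * (1 - Phi x) - \<phi> x" for x
  have D: "DERIV g x :> (1 - Phi x) - c * \<phi> x" for x
    unfolding g_def
    by (auto intro!: derivative_eq_intros DERIV_Phi DERIV_std_normal_density simp: algebra_simps)
  have "0 \<le> g x"
  proof (rule nonneg_of_antitone_tendsto_0[where f=g and l="\<lambda>y. - \<phi> y"])
    fix y assume xy: "x \<le> y"
    show "g y \<le> g x"
    proof (rule DERIV_nonpos_imp_nonincreasing[OF xy])
      fix z assume "x \<le> z" "z \<le> y"
      then show "\<exists>d. DERIV g z :> d \<and> d \<le> 0" 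
        using D[of z] gaussian_tail_le[of z] assms by (intro exI conjI) (auto simp: c_def)
    qed
    show "- \<phi> y \<le> g y"
      using assms xy Phi_less_1[of y] by (auto simp: g_def c_def)
  next
    show "((\<lambda>y. - \<phi> y) \<longlongrightarrow> 0) at_top"
      using tendsto_minus[OF std_normal_density_tendsto_0] by simp
  qed
  then show ?thesis by (simp add: g_def c_def)
qed

section \<open>Log-odds of the normal distribution function\<close>

definition logit_Phi :: "real \<Rightarrow> real" where
  "logit_Phi x = ln (Phi x / (1 - Phi x))"

lemma exp_logit_Phi: "exp (logit_Phi x) = Phi x / (1 - Phi x)"
  using Phi_pos[of x] Phi_less_1[of x] by (simp add: logit_Phi_def)

text \<open>The log-odds have derivative \<open>\<phi> / (Phi * (1 - Phi))\<close>, which is at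
  least \<open>1 / sqrt (pi / 2)\<close> by \<open>Phi_mult_le\<close>; hence \<open>?K\<close> is
  nondecreasing.\<close>

lemma diff_le_logit_Phi_diff:
  assumes "x \<le> y"
  shows "y - x \<le> sqrt (pi / 2) * (logit_Phi y - logit_Phi x)"
proof -
  let ?K = "\<lambda>x. sqrt (pi / 2) * logit_Phi x - x"
  have "?K x \<le> ?K y"
  proof (rule DERIV_nonneg_imp_nondecreasing[OF assms])
    fix z
    have p: "0 < Phi z" "0 < 1 - Phi z" using Phi_pos[of z] Phi_less_1[of z] by auto
    have "DERIV (\<lambda>x. sqrt (pi / 2) * (ln (Phi x) - ln (1 - Phi x)) - x) z :>
       sqrt (pi / 2) * (\<phi> z / (Phi z * (1 - Phi z))) - 1"
      using p by (auto intro!: derivative_eq_intros DERIV_Phi simp: field_simps)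
    also have "(\<lambda>x. sqrt (pi / 2) * (ln (Phi x) - ln (1 - Phi x)) - x) = ?K"
      using Phi_pos less_imp_neq[OF Phi_less_1]
      by (auto simp: fun_eq_iff logit_Phi_def ln_div less_imp_neq[OF Phi_pos, symmetric])
    finally show "\<exists>d. DERIV ?K z :> d \<and> 0 \<le> d"
      using Phi_mult_le[of z] p by (intro exI conjI) (auto simp: pos_le_divide_eq)
  qed
  then show ?thesis by (simp add: algebra_simps)
qed

text \<open>The right-hand side is the square of \<open>2 * sinh (d / 2)\<close>, and
  \<open>sinh t \<ge> t\<close> for \<open>t \<ge> 0\<close>. It turns a squared log-ratio into the
  ratio and its inverse.\<close>

lemma square_le_exp_plus_exp_minus:
  fixes d :: real
  shows "d\<^sup>2 \<le> exp d + exp (- d) - 2"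
proof -
  have *: "d\<^sup>2 \<le> exp d + exp (- d) - 2" if "0 \<le> d" for d :: real
  proof -
    have "d / 2 \<le> (exp (d / 2) - inverse (exp (d / 2))) / 2"
      using that by (intro real_le_x_sinh) simp
    then have "d\<^sup>2 \<le> (exp (d / 2) - inverse (exp (d / 2)))\<^sup>2"
      using that by (intro power_mono) auto
    also have "\<dots> = exp d + exp (- d) - 2"
      by (simp add: power2_diff power_inverse exp_double[symmetric] exp_minus)
    finally show ?thesis .
  qed
  show ?thesis using *[of d] *[of "-d"] by (cases "0 \<le> d") auto
qed

subsection \<open>The law of an order statistic\<close>

text \<open>In a sorted list the entries at most \<open>t\<close> form a prefix.\<close>

lemma sorted_nth_le_iff:
  fixes ys :: "'a :: linorder list"
  assumes "sorted ys" "k < length ys"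
  shows "ys ! k \<le> t \<longleftrightarrow> k < length (filter (\<lambda>y. y \<le> t) ys)"
  using assms
proof (induction ys arbitrary: k)
  case (Cons y ys)
  show ?case
  proof (cases "y \<le> t")
    case True
    with Cons show ?thesis by (cases k) auto
  next
    case False
    with Cons.prems have "z > t" if "z \<in> set (y # ys)" for z using that by force
    then have "filter (\<lambda>y. y \<le> t) (y # ys) = []" "(y # ys) ! k > t"
      using Cons.prems(2) nth_mem[of k "y # ys"] by (auto simp: filter_empty_conv not_le simp del: nth_mem)
    then show ?thesis by (metis leD length_0_conv not_less_zero)
  qed
qed simp

text \<open>Trades sorting for counting; both the measurability and the law of an order statistic
  are read off from the count.\<close>

lemma order_stat_le_iff:
  assumes "i \<in> {1..n}"
  shows "order_stat n i x \<le> t \<longleftrightarrow> i \<le> card {j. j < n \<and> x j \<le> t}"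
proof -
  have "order_stat n i x \<le> t \<longleftrightarrow> i - 1 < length (filter (\<lambda>y. y \<le> t) (sort (map x [0..<n])))"
    unfolding order_stat_def using assms by (intro sorted_nth_le_iff) auto
  also have "length (filter (\<lambda>y. y \<le> t) (sort (map x [0..<n]))) = length (filter (\<lambda>y. y \<le> t) (map x [0..<n]))"
    by (simp add: filter_sort)
  also have "\<dots> = card {j. j < n \<and> x j \<le> t}"
    by (auto simp: length_filter_conv_card intro!: arg_cong[where f=card])
  finally show ?thesis using assms by auto
qed

text \<open>Sorting permutes the entries, so the two sums run over the same multiset.\<close>

lemma sum_order_stat:
  "(\<Sum>i=1..n. f (order_stat n i x)) = (\<Sum>j<n. f (x j) :: 'a :: comm_monoid_add)"
proof -
  have "(\<Sum>i=1..n. f (order_stat n i x)) = (\<Sum>i<n. map f (sort (map x [0..<n])) ! i)"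
    by (rule sum.reindex_bij_witness[where i="\<lambda>i. i + 1" and j="\<lambda>i. i - 1"]) (auto simp: order_stat_def)
  also have "\<dots> = sum_list (map f (sort (map x [0..<n])))"
    by (simp add: sum_list_sum_nth atLeast0LessThan)
  also have "\<dots> = sum_mset (image_mset f (mset (sort (map x [0..<n]))))"
    by (simp only: sum_mset_sum_list[symmetric] mset_map)
  also have "\<dots> = sum_list (map (\<lambda>j. f (x j)) [0..<n])"
    by (simp only: mset_sort mset_map[symmetric] sum_mset_sum_list map_map comp_def)
  also have "\<dots> = (\<Sum>j<n. f (x j))"
    by (simp add: sum_list_sum_nth atLeast0LessThan)
  finally show ?thesis .
qed

section \<open>The distribution function of an order statistic\<close>

lemma space_gauss_vec: "space (gauss_vec n) = ({..<n} \<rightarrow>\<^sub>E UNIV)"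
  by (simp add: gauss_vec_def space_PiM)

lemma sets_gauss_vec [measurable_cong]: "sets (gauss_vec n) = sets (PiM {..<n} (\<lambda>_. borel))"
  unfolding gauss_vec_def by (intro sets_PiM_cong) auto

lemma prob_space_gauss_vec: "prob_space (gauss_vec n)"
  unfolding gauss_vec_def using real_distribution.axioms(1)[OF real_dist_normal_dist]
  by (intro prob_space_PiM)

lemma borel_measurable_order_stat:
  assumes "i \<in> {1..n}"
  shows "order_stat n i \<in> borel_measurable (gauss_vec n)"
  unfolding borel_measurable_iff_le
proof
  fix t
  \<comment> \<open>As a finite sum of indicators of single coordinates, the count is visibly
    measurable.\<close>
  have "{x \<in> space (gauss_vec n). i \<le> card {j. j < n \<and> x j \<le> t}} =
     {x \<in> space (gauss_vec n). real i \<le> (\<Sum>j<n. indicator {..t} (x j))}"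
    by (simp add: indicator_def sum.If_cases lessThan_def Collect_conj_eq)
  also have "\<dots> \<in> sets (gauss_vec n)"
    by measurable
  finally show "{x \<in> space (gauss_vec n). order_stat n i x \<le> t} \<in> sets (gauss_vec n)"
    by (simp add: order_stat_le_iff[OF assms])
qed

lemma measure_std_normal_greaterThan: "measure std_normal_distribution {t<..} = 1 - Phi t"
proof -
  interpret real_distribution std_normal_distribution by (rule real_dist_normal_dist)
  show ?thesis
    using prob_compl[of "{..t}"] by (simp add: Phi_def Compl_eq_Diff_UNIV[symmetric])
qed

text \<open>For \<open>u\<close> in the unit interval this is the probability of at least
  \<open>i\<close> successes in \<open>n\<close> independent trials with success probability
  \<open>u\<close>.\<close>

definition binomial_tail :: "nat \<Rightarrow> nat \<Rightarrow> real \<Rightarrow> real" where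
  "binomial_tail n i u = (\<Sum>k=i..n. real (n choose k) * u ^ k * (1 - u) ^ (n - k))"

text \<open>The event splits into disjoint boxes according to the exact set \<open>S\<close> of
  coordinates that are at most \<open>t\<close>. By independence a box has a probability depending
  only on \<open>card S\<close>, and there are \<open>n choose k\<close> sets of size
  \<open>k\<close>.\<close>

lemma prob_order_stat_le:
  assumes i: "i \<in> {1..n}"
  shows "measure (gauss_vec n) {x \<in> space (gauss_vec n). order_stat n i x \<le> t} = binomial_tail n i (Phi t)"
proof -
  interpret std: real_distribution std_normal_distribution by (rule real_dist_normal_dist)
  interpret P: prob_space "gauss_vec n" by (rule prob_space_gauss_vec)
  interpret product_sigma_finite "\<lambda>_::nat. std_normal_distribution" ..
  define \<S> where "\<S> k = {S. S \<subseteq> {..<n} \<and> card S = k}" for k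
  define box where "box S = ({..<n} \<rightarrow>\<^sub>E UNIV) \<inter> {x. {j. j < n \<and> x j \<le> t} = S}" for S
  have fin: "finite (\<S> k)" for k
    unfolding \<S>_def by (rule finite_subset[of _ "Pow {..<n}"]) auto
  have box: "box S = (\<Pi>\<^sub>E j\<in>{..<n}. if j \<in> S then {..t} else {t<..})" if "S \<subseteq> {..<n}" for S
  proof (rule set_eqI)
    fix x :: "nat \<Rightarrow> real"
    have "{j. j < n \<and> x j \<le> t} = S \<longleftrightarrow> (\<forall>j<n. x j \<le> t \<longleftrightarrow> j \<in> S)"
      using that by auto
    also have "\<dots> \<longleftrightarrow> (\<forall>j<n. x j \<in> (if j \<in> S then {..t} else {t<..}))"
      by (auto simp: not_le)
    finally show "x \<in> box S \<longleftrightarrow> x \<in> (\<Pi>\<^sub>E j\<in>{..<n}. if j \<in> S then {..t} else {t<..})"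
      by (auto simp: box_def PiE_iff)
  qed
  have meas: "box S \<in> sets (gauss_vec n)" if "S \<subseteq> {..<n}" for S
    unfolding box[OF that] sets_gauss_vec by (intro sets_PiM_I_finite) auto
  have prob: "measure (gauss_vec n) (box S) = Phi t ^ card S * (1 - Phi t) ^ (n - card S)" if "S \<subseteq> {..<n}" for S
  proof -
    have "emeasure (gauss_vec n) (box S) =
        (\<Prod>j<n. emeasure std_normal_distribution (if j \<in> S then {..t} else {t<..}))"
      unfolding box[OF that] gauss_vec_def by (intro emeasure_PiM) auto
    also have "\<dots> = (\<Prod>j<n. ennreal (if j \<in> S then Phi t else 1 - Phi t))"
      by (intro prod.cong) (auto simp: std.emeasure_eq_measure measure_std_normal_greaterThan Phi_def)
    also have "\<dots> = ennreal (\<Prod>j<n. if j \<in> S then Phi t else 1 - Phi t)"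
      using Phi_pos[of t] Phi_less_1[of t] by (intro prod_ennreal) auto
    also have "(\<Prod>j<n. if j \<in> S then Phi t else 1 - Phi t) = Phi t ^ card S * (1 - Phi t) ^ (n - card S)"
      using that by (simp add: prod.If_cases Int_absorb1 Diff_eq[symmetric] card_Diff_subset finite_subset[OF that])
    finally show ?thesis
      using Phi_pos[of t] Phi_less_1[of t] by (simp add: measure_def)
  qed
  have eq: "{x \<in> space (gauss_vec n). order_stat n i x \<le> t} = (\<Union>S\<in>(\<Union>k\<in>{i..n}. \<S> k). box S)"
  proof -
    have "card {j. j < n \<and> x j \<le> t} \<le> n" for x :: "nat \<Rightarrow> real"
      using card_mono[of "{..<n}" "{j. j < n \<and> x j \<le> t}"] by auto
    then show ?thesis
      by (auto simp: order_stat_le_iff[OF i] space_gauss_vec box_def \<S>_def)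
  qed
  have "measure (gauss_vec n) {x \<in> space (gauss_vec n). order_stat n i x \<le> t} =
      (\<Sum>S\<in>(\<Union>k\<in>{i..n}. \<S> k). measure (gauss_vec n) (box S))"
    unfolding eq
  proof (rule P.finite_measure_finite_Union)
    show "box ` (\<Union>k\<in>{i..n}. \<S> k) \<subseteq> sets (gauss_vec n)"
      using meas by (auto simp: \<S>_def)
    show "disjoint_family_on box (\<Union>k\<in>{i..n}. \<S> k)"
      by (auto simp: disjoint_family_on_def box_def)
  qed (use fin in auto)
  also have "\<dots> = (\<Sum>k=i..n. \<Sum>S\<in>\<S> k. measure (gauss_vec n) (box S))"
    using fin by (intro sum.UNION_disjoint) (auto simp: \<S>_def)
  also have "\<dots> = (\<Sum>k=i..n. \<Sum>S\<in>\<S> k. Phi t ^ k * (1 - Phi t) ^ (n - k))"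
    by (intro sum.cong) (auto simp: prob \<S>_def)
  also have "\<dots> = binomial_tail n i (Phi t)"
    by (simp add: binomial_tail_def \<S>_def n_subsets mult.assoc)
  finally show ?thesis .
qed

section \<open>The density of an order statistic\<close>

lemma Suc_times_choose_Suc: "Suc k * (n choose Suc k) = (n - k) * (n choose k)"
  by (simp only: binomial_absorption binomial_absorb_comp)

text \<open>Downward induction from the empty tail at \<open>i = Suc n\<close>. The leading term
  differentiates to a difference of two terms, and the subtracted one cancels the derivative of the
  remaining tail, so the sum telescopes.\<close>

lemma DERIV_binomial_tail:
  assumes "i \<le> Suc n"
  shows "DERIV (binomial_tail n i) u :> real (i * (n choose i)) * u ^ (i - 1) * (1 - u) ^ (n - i)"
  using assms
proof (induction i rule: inc_induct)
  case base
  show ?case by (simp add: binomial_tail_def[abs_def] binomial_eq_0)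
next
  case (step i)
  then have i: "i \<le> n" by simp
  have split: "binomial_tail n i = (\<lambda>u. real (n choose i) * u ^ i * (1 - u) ^ (n - i) + binomial_tail n (Suc i) u)"
    using i by (simp add: binomial_tail_def sum.atLeast_Suc_atMost fun_eq_iff)
  have "real (Suc i * (n choose Suc i)) = real (n - i) * real (n choose i)"
    by (metis of_nat_mult Suc_times_choose_Suc)
  moreover have "DERIV (\<lambda>u. real (n choose i) * u ^ i * (1 - u) ^ (n - i)) u :>
      real (n choose i) * (real i * u ^ (i - 1) * (1 - u) ^ (n - i)) -
      real (n - i) * real (n choose i) * u ^ i * (1 - u) ^ (n - Suc i)"
    by (auto intro!: derivative_eq_intros simp: algebra_simps)
  ultimately show ?case
    unfolding split using DERIV_add[OF _ step.IH] by (fastforce simp: mult_ac)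
qed

lemma binomial_tail_1: "i \<le> n \<Longrightarrow> binomial_tail n i 1 = 1"
  unfolding binomial_tail_def
  by (subst sum.mono_neutral_right[where S="{n}"]) auto

text \<open>For \<open>1 \<le> i \<le> n\<close> this is the density of the Beta distribution with
  parameters \<open>i\<close> and \<open>n + 1 - i\<close>, taken at \<open>Phi x\<close> and
  multiplied by the derivative of \<open>Phi\<close>.\<close>

definition order_stat_density :: "nat \<Rightarrow> nat \<Rightarrow> real \<Rightarrow> real" where
  "order_stat_density n i x = real (i * (n choose i)) * Phi x ^ (i - 1) * (1 - Phi x) ^ (n - i) * \<phi> x"

lemma order_stat_density_nonneg: "0 \<le> order_stat_density n i x"
  using Phi_pos[of x] Phi_less_1[of x] by (simp add: order_stat_density_def)

lemma borel_measurable_order_stat_density [measurable]: "order_stat_density n i \<in> borel_measurable borel"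
  unfolding order_stat_density_def[abs_def] by measurable

text \<open>It suffices to compare the measures of the rays \<open>{t<..}\<close>. There
  \<open>binomial_tail n i (Phi x)\<close> is an antiderivative of the density with limit 1 at
  infinity.\<close>

lemma distr_order_stat:
  assumes i: "i \<in> {1..n}"
  shows "distr (gauss_vec n) borel (order_stat n i) = density lborel (order_stat_density n i)"
proof (rule measure_eqI_lessThan)
  interpret P: prob_space "gauss_vec n" by (rule prob_space_gauss_vec)
  note [measurable] = borel_measurable_order_stat[OF i]
  interpret X: prob_space "distr (gauss_vec n) borel (order_stat n i)"
    by (rule P.prob_space_distr) simp
  fix t
  show "emeasure (distr (gauss_vec n) borel (order_stat n i)) {t<..} < \<infinity>"
    by (simp add: X.emeasure_eq_measure)
  have D: "DERIV (\<lambda>x. binomial_tail n i (Phi x)) x :> order_stat_density n i x" for x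
    using DERIV_chain2[OF DERIV_binomial_tail[of i n] DERIV_Phi] i by (simp add: order_stat_density_def)
  have "isCont (binomial_tail n i) 1"
    using DERIV_isCont[OF DERIV_binomial_tail] i by simp
  then have lim: "((\<lambda>x. binomial_tail n i (Phi x)) \<longlongrightarrow> 1) at_top"
    using isCont_tendsto_compose[OF _ Phi_tendsto_1] binomial_tail_1[of i n] i by fastforce
  have "emeasure (distr (gauss_vec n) borel (order_stat n i)) {t<..} =
      measure (gauss_vec n) (space (gauss_vec n) - {x \<in> space (gauss_vec n). order_stat n i x \<le> t})"
    by (simp add: emeasure_distr P.emeasure_eq_measure)
      (auto simp: not_le intro!: arg_cong[where f="measure (gauss_vec n)"])
  also have "\<dots> = ennreal (1 - binomial_tail n i (Phi t))"
    by (subst P.prob_compl) (simp_all add: prob_order_stat_le[OF i])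
  also have "\<dots> = (\<integral>\<^sup>+x. ennreal (order_stat_density n i x) * indicator {t..} x \<partial>lborel)"
    using nn_integral_FTC_atLeast[OF _ D order_stat_density_nonneg lim] by simp
  also have "\<dots> = (\<integral>\<^sup>+x. ennreal (order_stat_density n i x) * indicator {t<..} x \<partial>lborel)"
    by (intro nn_integral_cong_AE AE_I[where N="{t}"]) (auto split: split_indicator)
  also have "\<dots> = emeasure (density lborel (order_stat_density n i)) {t<..}"
    by (simp add: emeasure_density)
  finally show "emeasure (distr (gauss_vec n) borel (order_stat n i)) {t<..} =
      emeasure (density lborel (order_stat_density n i)) {t<..}" .
qed simp_all

lemma
  fixes g :: "real \<Rightarrow> real"
  assumes i: "i \<in> {1..n}" and [measurable]: "g \<in> borel_measurable borel"
  shows integral_order_stat: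
      "(\<integral>x. g (order_stat n i x) \<partial>gauss_vec n) = (\<integral>x. order_stat_density n i x * g x \<partial>lborel)"
    and integrable_order_stat_iff:
      "integrable (gauss_vec n) (\<lambda>x. g (order_stat n i x)) \<longleftrightarrow>
       integrable lborel (\<lambda>x. order_stat_density n i x * g x)"
  using integral_distr[OF borel_measurable_order_stat[OF i] assms(2)]
    integrable_distr_eq[OF borel_measurable_order_stat[OF i] assms(2)]
    integral_density[of g lborel "order_stat_density n i"]
    integrable_density[of g lborel "order_stat_density n i"]
  by (simp_all add: distr_order_stat[OF i] order_stat_density_nonneg)

text \<open>The normalisation is inherited from the probability space by integrating the constant 1,
  so no beta integral has to be evaluated.\<close>

lemma has_bochner_integral_order_stat_density:
  assumes "i \<in> {1..n}"
  shows "has_bochner_integral lborel (order_stat_density n i) 1"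
proof -
  interpret prob_space "gauss_vec n" by (rule prob_space_gauss_vec)
  show ?thesis
    using integral_order_stat[OF assms, of "\<lambda>_. 1"] integrable_order_stat_iff[OF assms, of "\<lambda>_. 1"]
    by (simp add: has_bochner_integral_iff prob_space)
qed

text \<open>The odds shift one power from \<open>1 - Phi x\<close> to \<open>Phi x\<close>; since
  \<open>i < n\<close> there is such a power to cancel. The constants match by binomial
  absorption.\<close>

lemma order_stat_density_odds:
  assumes "1 \<le> i" "i < n"
  shows "order_stat_density n i x * (Phi x / (1 - Phi x)) =
    real i / real (n - i) * order_stat_density n (Suc i) x"
proof -
  obtain k m where k: "i = Suc k" and m: "n - i = Suc m"
    using assms by (metis Suc_le_D One_nat_def zero_less_diff gr0_conv_Suc)
  have c: "real (Suc i * (n choose Suc i)) = real (n - i) * real (n choose i)"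
    by (metis of_nat_mult Suc_times_choose_Suc)
  have "n - Suc i = m" using m by simp
  then show ?thesis
    using Phi_less_1[of x] assms
    unfolding order_stat_density_def c m by (simp add: k field_simps)
qed

lemma order_stat_density_inverse_odds:
  assumes "2 \<le> i" "i \<le> n"
  shows "order_stat_density n i x * ((1 - Phi x) / Phi x) =
    real (n + 1 - i) / real (i - 1) * order_stat_density n (i - 1) x"
proof -
  have n: "n - (i - 1) = n + 1 - i" using assms by simp
  have "order_stat_density n (i - 1) x * (Phi x / (1 - Phi x)) =
      real (i - 1) / real (n + 1 - i) * order_stat_density n i x"
    using order_stat_density_odds[of "i - 1" n x] assms unfolding n by simp
  then show ?thesis
    using Phi_pos[of x] Phi_less_1[of x] assms by (simp add: field_simps)
qed

lemma has_bochner_integral_odds: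
  assumes "1 \<le> i" "i < n"
  shows "has_bochner_integral lborel (\<lambda>x. order_stat_density n i x * (Phi x / (1 - Phi x))) (real i / real (n - i))"
  unfolding order_stat_density_odds[OF assms]
  using has_bochner_integral_mult_right[OF has_bochner_integral_order_stat_density[of "Suc i" n],
      of "real i / real (n - i)"] assms
  by simp

lemma has_bochner_integral_inverse_odds:
  assumes "2 \<le> i" "i \<le> n"
  shows "has_bochner_integral lborel (\<lambda>x. order_stat_density n i x * ((1 - Phi x) / Phi x))
    (real (n + 1 - i) / real (i - 1))"
  unfolding order_stat_density_inverse_odds[OF assms]
  using has_bochner_integral_mult_right[OF has_bochner_integral_order_stat_density[of "i - 1" n],
      of "real (n + 1 - i) / real (i - 1)"] assms
  by force

lemma order_stat_density_uminus:
  assumes "i \<in> {1..n}"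
  shows "order_stat_density n i (- x) = order_stat_density n (n + 1 - i) x"
proof -
  obtain k where k: "i = Suc k" using assms by (cases i) auto
  have "i * (n choose i) = (n - k) * (n choose k)"
    unfolding k by (rule Suc_times_choose_Suc)
  also have "\<dots> = (n + 1 - i) * (n choose (n + 1 - i))"
    using assms binomial_symmetric[of k n] by (simp add: k)
  finally have c: "i * (n choose i) = (n + 1 - i) * (n choose (n + 1 - i))" .
  have "n + 1 - i - 1 = n - i" "n - (n + 1 - i) = i - 1" using assms by auto
  then show ?thesis
    unfolding order_stat_density_def c by (simp add: Phi_uminus std_normal_density_even)
qed

section \<open>Second moments and reflection\<close>

lemma
  assumes "j < n"
  shows integrable_component_square: "integrable (gauss_vec n) (\<lambda>x. (x j)\<^sup>2)"
    and integral_component_square: "(\<integral>x. (x j)\<^sup>2 \<partial>gauss_vec n) = 1"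
proof -
  interpret std: real_distribution std_normal_distribution by (rule real_dist_normal_dist)
  have d: "distr (gauss_vec n) std_normal_distribution (\<lambda>x. x j) = std_normal_distribution"
    unfolding gauss_vec_def using assms by (intro distr_PiM_component) (auto intro: std.prob_space_axioms)
  have m: "(\<lambda>x. x j) \<in> measurable (gauss_vec n) std_normal_distribution"
    unfolding gauss_vec_def using assms by (intro measurable_component_singleton) simp
  have "integrable (distr (gauss_vec n) std_normal_distribution (\<lambda>x. x j)) (\<lambda>x. x\<^sup>2)"
    unfolding d by (rule integrable_std_normal_distribution_moment)
  then show "integrable (gauss_vec n) (\<lambda>x. (x j)\<^sup>2)"
    by (subst (asm) integrable_distr_eq[OF m]) auto
  have "(\<integral>x. x\<^sup>2 \<partial>distr (gauss_vec n) std_normal_distribution (\<lambda>x. x j)) = 1"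
    unfolding d using std_normal_distribution_even_moments(1)[of 1] by simp
  then show "(\<integral>x. (x j)\<^sup>2 \<partial>gauss_vec n) = 1"
    by (subst (asm) integral_distr[OF m]) auto
qed

text \<open>One squared entry is at most the sum of all of them, which sorting leaves
  unchanged.\<close>

lemma integrable_order_stat_square:
  assumes i: "i \<in> {1..n}"
  shows "integrable (gauss_vec n) (\<lambda>x. (order_stat n i x)\<^sup>2)"
proof (rule Bochner_Integration.integrable_bound)
  note [measurable] = borel_measurable_order_stat[OF i]
  show "integrable (gauss_vec n) (\<lambda>x. \<Sum>j<n. (x j)\<^sup>2)"
    by (intro Bochner_Integration.integrable_sum integrable_component_square) auto
  show "(\<lambda>x. (order_stat n i x)\<^sup>2) \<in> borel_measurable (gauss_vec n)" by measurable
  show "AE x in gauss_vec n. norm ((order_stat n i x)\<^sup>2) \<le> norm (\<Sum>j<n. (x j)\<^sup>2)"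
  proof (rule AE_I2)
    fix x
    have "(order_stat n i x)\<^sup>2 \<le> (\<Sum>i=1..n. (order_stat n i x)\<^sup>2)"
      using i by (intro member_le_sum) auto
    also have "\<dots> = (\<Sum>j<n. (x j)\<^sup>2)"
      by (rule sum_order_stat)
    finally show "norm ((order_stat n i x)\<^sup>2) \<le> norm (\<Sum>j<n. (x j)\<^sup>2)"
      by (simp add: sum_nonneg)
  qed
qed

lemma integrable_order_stat:
  assumes "i \<in> {1..n}"
  shows "integrable (gauss_vec n) (order_stat n i)"
proof -
  interpret prob_space "gauss_vec n" by (rule prob_space_gauss_vec)
  show ?thesis
    by (rule square_integrable_imp_integrable[OF borel_measurable_order_stat[OF assms]
        integrable_order_stat_square[OF assms]])
qed

lemma sum_integral_order_stat_square:
  "(\<Sum>i=1..n. \<integral>x. (order_stat n i x)\<^sup>2 \<partial>gauss_vec n) = real n"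
proof -
  have "(\<Sum>i=1..n. \<integral>x. (order_stat n i x)\<^sup>2 \<partial>gauss_vec n) =
      (\<integral>x. (\<Sum>i=1..n. (order_stat n i x)\<^sup>2) \<partial>gauss_vec n)"
    by (intro Bochner_Integration.integral_sum[symmetric] integrable_order_stat_square)
  also have "\<dots> = (\<Sum>j<n. \<integral>x. (x j)\<^sup>2 \<partial>gauss_vec n)"
    unfolding sum_order_stat[of "\<lambda>y. y\<^sup>2"]
    by (intro Bochner_Integration.integral_sum integrable_component_square) auto
  finally show ?thesis by (simp add: integral_component_square)
qed

text \<open>The substitution of \<open>- x\<close> for \<open>x\<close> exchanges \<open>Phi\<close>
  with \<open>1 - Phi\<close> and thereby the ranks \<open>i\<close> and
  \<open>n + 1 - i\<close>.\<close>

lemma integral_order_stat_reflect: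
  assumes i: "i \<in> {1..n}"
  shows "(\<integral>x. order_stat n (n + 1 - i) x \<partial>gauss_vec n) = - (\<integral>x. order_stat n i x \<partial>gauss_vec n)"
proof -
  have i': "n + 1 - i \<in> {1..n}" using i by auto
  have "(\<integral>x. order_stat n i x \<partial>gauss_vec n) = (\<integral>x. order_stat_density n i x * x \<partial>lborel)"
    using integral_order_stat[OF i, of "\<lambda>x. x"] by simp
  also have "\<dots> = (\<integral>x. order_stat_density n i (- x) * (- x) \<partial>lborel)"
    using lborel_integral_real_affine[of "-1" "\<lambda>x. order_stat_density n i x * x" 0] by simp
  also have "\<dots> = - (\<integral>x. order_stat_density n (n + 1 - i) x * x \<partial>lborel)"
    unfolding order_stat_density_uminus[OF i] by simp
  also have "(\<integral>x. order_stat_density n (n + 1 - i) x * x \<partial>lborel) = (\<integral>x. order_stat n (n + 1 - i) x \<partial>gauss_vec n)"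
    using integral_order_stat[OF i', of "\<lambda>x. x"] by simp
  finally show ?thesis by simp
qed

subsection \<open>The bias of an order statistic\<close>

lemma exp_logit_Phi_diff: "exp (logit_Phi x - logit_Phi y) = (Phi x / (1 - Phi x)) * ((1 - Phi y) / Phi y)"
  using Phi_pos[of y] Phi_less_1[of y] by (simp add: exp_diff exp_logit_Phi)

lemma square_diff_le_odds:
  "(x - q)\<^sup>2 \<le> pi / 2 * ((Phi x / (1 - Phi x)) * ((1 - Phi q) / Phi q) +
    ((1 - Phi x) / Phi x) * (Phi q / (1 - Phi q)) - 2)"
proof -
  \<comment> \<open>\<open>exp d\<close> is the ratio of the odds at \<open>x\<close> and at
    \<open>q\<close>.\<close>
  define d where "d = logit_Phi x - logit_Phi q"
  have "\<bar>x - q\<bar> \<le> sqrt (pi / 2) * \<bar>d\<bar>"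
  proof (cases "q \<le> x")
    case True
    then have "\<bar>x - q\<bar> \<le> sqrt (pi / 2) * d"
      using diff_le_logit_Phi_diff[of q x] by (simp add: d_def)
    also have "\<dots> \<le> sqrt (pi / 2) * \<bar>d\<bar>" by (intro mult_left_mono) auto
    finally show ?thesis .
  next
    case False
    then have "\<bar>x - q\<bar> \<le> sqrt (pi / 2) * - d"
      using diff_le_logit_Phi_diff[of x q] by (simp add: d_def)
    also have "\<dots> \<le> sqrt (pi / 2) * \<bar>d\<bar>" by (intro mult_left_mono) auto
    finally show ?thesis .
  qed
  then have "\<bar>x - q\<bar>\<^sup>2 \<le> (sqrt (pi / 2) * \<bar>d\<bar>)\<^sup>2"
    by (intro power_mono) auto
  then have "(x - q)\<^sup>2 \<le> pi / 2 * d\<^sup>2"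
    by (simp add: power_mult_distrib)
  also have "\<dots> \<le> pi / 2 * (exp d + exp (- d) - 2)"
    by (intro mult_left_mono square_le_exp_plus_exp_minus) auto
  also have "exp d = (Phi x / (1 - Phi x)) * ((1 - Phi q) / Phi q)"
    unfolding d_def by (rule exp_logit_Phi_diff)
  also have "exp (- d) = ((1 - Phi x) / Phi x) * (Phi q / (1 - Phi q))"
    unfolding d_def using exp_logit_Phi_diff[of q x] by (simp add: mult.commute)
  finally show ?thesis .
qed

text \<open>A one-sided, first-order companion of \<open>square_diff_le_odds\<close> in which only
  the inverse odds at \<open>x\<close> occur. It rests on \<open>d \<le> exp d / 2\<close>; for
  \<open>x > q\<close> the signs decide.\<close>

lemma diff_le_inverse_odds:
  "q - x \<le> sqrt (pi / 2) / 2 * (Phi q / (1 - Phi q)) * ((1 - Phi x) / Phi x)"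
proof (cases "x \<le> q")
  case True
  define d where "d = logit_Phi q - logit_Phi x"
  have "q - x \<le> sqrt (pi / 2) * d"
    unfolding d_def by (rule diff_le_logit_Phi_diff[OF True])
  also have "\<dots> \<le> sqrt (pi / 2) * (exp d / 2)"
  proof (rule mult_left_mono)
    \<comment> \<open>The intermediate bound \<open>2 * exp (d / 2) - 2\<close> is linked to
      \<open>exp d / 2\<close> by expanding the square of \<open>exp (d / 2) - 2\<close>.\<close>
    have "d \<le> 2 * exp (d / 2) - 2" using exp_ge_add_one_self[of "d / 2"] by linarith
    moreover have "2 * exp (d / 2) - 2 \<le> exp d / 2"
      using zero_le_power2[of "exp (d / 2) - 2"] exp_double[of "d / 2"] by (simp add: power2_diff)
    ultimately show "d \<le> exp d / 2" by simp
  qed simp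
  also have "\<dots> = sqrt (pi / 2) / 2 * exp d" by simp
  also have "exp d = (Phi q / (1 - Phi q)) * ((1 - Phi x) / Phi x)"
    unfolding d_def by (rule exp_logit_Phi_diff)
  finally show ?thesis by (simp only: mult.assoc)
next
  case False
  have "0 \<le> sqrt (pi / 2) / 2 * (Phi q / (1 - Phi q)) * ((1 - Phi x) / Phi x)"
    using Phi_pos[of q] Phi_less_1[of q] Phi_pos[of x] Phi_less_1[of x]
    by (intro mult_nonneg_nonneg divide_nonneg_nonneg) auto
  with False show ?thesis by linarith
qed

lemma Phi_inv_odds:
  assumes "i \<in> {1..n}"
  defines "q \<equiv> Phi_inv (real i / real (n + 1))"
  shows "Phi q = real i / real (n + 1)" "1 - Phi q = real (n + 1 - i) / real (n + 1)"
    "Phi q / (1 - Phi q) = real i / real (n + 1 - i)" "(1 - Phi q) / Phi q = real (n + 1 - i) / real i"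
proof -
  show 1: "Phi q = real i / real (n + 1)"
    unfolding q_def using assms(1) by (intro Phi_Phi_inv) auto
  show 2: "1 - Phi q = real (n + 1 - i) / real (n + 1)"
    unfolding 1 using assms(1) by (simp add: of_nat_diff field_simps)
  show "Phi q / (1 - Phi q) = real i / real (n + 1 - i)" "(1 - Phi q) / Phi q = real (n + 1 - i) / real i"
    unfolding 2 unfolding 1 by auto
qed

text \<open>The mean square error exceeds the squared bias by the variance.\<close>

lemma square_bias_le_mean_square_error:
  assumes i: "i \<in> {1..n}"
  shows "((\<integral>x. order_stat n i x \<partial>gauss_vec n) - q)\<^sup>2 \<le> (\<integral>x. (order_stat n i x - q)\<^sup>2 \<partial>gauss_vec n)"
proof -
  interpret prob_space "gauss_vec n" by (rule prob_space_gauss_vec)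
  note int = integrable_order_stat[OF i] integrable_order_stat_square[OF i]
  have "0 \<le> variance (order_stat n i)" by (rule variance_positive)
  also have "\<dots> = expectation (\<lambda>x. (order_stat n i x)\<^sup>2) - (expectation (order_stat n i))\<^sup>2"
    using int by (rule variance_eq)
  finally show ?thesis
    using int by (simp add: power2_diff prob_space algebra_simps)
qed

lemma order_stat_bias_interior:
  assumes "2 \<le> i" "i < n"
  shows "((\<integral>x. order_stat n i x \<partial>gauss_vec n) - Phi_inv (real i / real (n + 1)))\<^sup>2
    \<le> pi / 2 * (2 / real i + 2 / real (n + 1 - i))"
proof -
  have i: "i \<in> {1..n}" using assms by auto
  define q where "q = Phi_inv (real i / real (n + 1))"
  define a b where "a = real i" and "b = real (n + 1 - i)"
  have ab: "a \<ge> 2" "b \<ge> 2" "real (n - i) = b - 1" "real (i - 1) = a - 1"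
    using assms by (auto simp: a_def b_def)
  note odds = Phi_inv_odds(3,4)[OF i, folded q_def, folded a_def b_def]
  have "((\<integral>x. order_stat n i x \<partial>gauss_vec n) - q)\<^sup>2 \<le> (\<integral>x. (order_stat n i x - q)\<^sup>2 \<partial>gauss_vec n)"
    by (rule square_bias_le_mean_square_error[OF i])
  also have "\<dots> = (\<integral>x. order_stat_density n i x * (x - q)\<^sup>2 \<partial>lborel)"
    by (rule integral_order_stat[OF i]) simp
  also have "\<dots> \<le> pi / 2 * ((b / a) * (a / (b - 1)) + (a / b) * (b / (a - 1)) - 2 * 1)"
  proof -
    \<comment> \<open>The majorant from \<open>square_diff_le_odds\<close> times the density,
      arranged as three functions with known integrals. Both odds integrals exist because
      \<open>2 \<le> i < n\<close>.\<close>
    let ?h = "\<lambda>x. pi / 2 * ((b / a) * (order_stat_density n i x * (Phi x / (1 - Phi x))) +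
      (a / b) * (order_stat_density n i x * ((1 - Phi x) / Phi x)) - 2 * order_stat_density n i x)"
    have "has_bochner_integral lborel ?h
      (pi / 2 * ((b / a) * (a / (b - 1)) + (a / b) * (b / (a - 1)) - 2 * 1))"
      using has_bochner_integral_odds[of i n] has_bochner_integral_inverse_odds[of i n]
        has_bochner_integral_order_stat_density[OF i] assms ab
      by (intro has_bochner_integral_mult_right has_bochner_integral_diff has_bochner_integral_add)
        (auto simp: a_def b_def)
    moreover have "(\<integral>x. order_stat_density n i x * (x - q)\<^sup>2 \<partial>lborel) \<le> integral\<^sup>L lborel ?h"
    proof (rule integral_mono)
      have "integrable (gauss_vec n) (\<lambda>x. (order_stat n i x - q)\<^sup>2)"
      proof -
        interpret prob_space "gauss_vec n" by (rule prob_space_gauss_vec)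
        show ?thesis
          unfolding power2_diff using integrable_order_stat[OF i] integrable_order_stat_square[OF i] by auto
      qed
      then show "integrable lborel (\<lambda>x. order_stat_density n i x * (x - q)\<^sup>2)"
        by (subst (asm) integrable_order_stat_iff[OF i, of "\<lambda>x. (x - q)\<^sup>2"]) auto
      show "integrable lborel ?h" using calculation by (simp add: has_bochner_integral_iff)
      fix x
      have "order_stat_density n i x * (x - q)\<^sup>2 \<le> order_stat_density n i x *
          (pi / 2 * ((Phi x / (1 - Phi x)) * (b / a) + ((1 - Phi x) / Phi x) * (a / b) - 2))"
        using square_diff_le_odds[of x q] order_stat_density_nonneg[of n i x]
        unfolding odds by (rule mult_left_mono)
      also have "\<dots> = ?h x" by (simp add: algebra_simps)
      finally show "order_stat_density n i x * (x - q)\<^sup>2 \<le> ?h x" .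
    qed
    ultimately show ?thesis by (simp add: has_bochner_integral_iff)
  qed
  \<comment> \<open>The quantile level \<open>i / (n + 1)\<close> has odds \<open>a / b\<close>, so
    each product is 1 plus a small term and the two units cancel the 2.\<close>
  also have "(b / a) * (a / (b - 1)) + (a / b) * (b / (a - 1)) - 2 * 1 = 1 / (a - 1) + 1 / (b - 1)"
  proof -
    have "(b / a) * (a / (b - 1)) = 1 + 1 / (b - 1)" "(a / b) * (b / (a - 1)) = 1 + 1 / (a - 1)"
      using ab(1,2) by (simp_all add: divide_simps)
    then show ?thesis by simp
  qed
  \<comment> \<open>From \<open>a \<ge> 2\<close> follows \<open>1 / (a - 1) \<le> 2 / a\<close>,
    and likewise for \<open>b\<close>.\<close>
  also have "pi / 2 * \<dots> \<le> pi / 2 * (2 / a + 2 / b)"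
    using ab by (intro mult_left_mono add_mono) (auto simp: field_simps)
  finally show ?thesis by (simp add: q_def a_def b_def)
qed

text \<open>This is the expected excess of a standard normal variable over the level
  \<open>q\<close>.\<close>

lemma has_bochner_integral_gaussian_excess:
  "has_bochner_integral lborel (\<lambda>x. (x - q) * \<phi> x * indicator {q..} x) (\<phi> q - q * (1 - Phi q))"
proof (rule has_bochner_integral_nn_integral)
  \<comment> \<open>With \<open>q\<close> fixed and only \<open>x\<close> moving, \<open>- F\<close>
    is an antiderivative of \<open>(x - q) * \<phi> x\<close> that vanishes at infinity.\<close>
  define F where "F x = \<phi> x - q * (1 - Phi x)" for x
  have "((\<lambda>x. \<phi> x - q * (1 - Phi x)) \<longlongrightarrow> 0 - q * (1 - 1)) at_top"
    by (intro tendsto_intros Phi_tendsto_1 std_normal_density_tendsto_0)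
  then have lim: "(F \<longlongrightarrow> 0) at_top" by (simp add: F_def[abs_def])
  have D: "DERIV F x :> - ((x - q) * \<phi> x)" for x
    unfolding F_def by (auto intro!: derivative_eq_intros DERIV_Phi DERIV_std_normal_density simp: algebra_simps)
  show "0 \<le> \<phi> q - q * (1 - Phi q)"
    unfolding F_def[symmetric]
  proof (rule nonneg_of_antitone_tendsto_0[where f=F and l=F])
    fix y assume "q \<le> y"
    then show "F y \<le> F q"
      by (rule DERIV_nonpos_imp_nonincreasing) (intro exI conjI, rule D, simp)
  qed (use lim in auto)
  have "(\<integral>\<^sup>+x. ennreal ((x - q) * \<phi> x * indicator {q..} x) \<partial>lborel) =
      (\<integral>\<^sup>+x. ennreal ((x - q) * \<phi> x) * indicator {q..} x \<partial>lborel)"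
    by (intro nn_integral_cong) (auto split: split_indicator)
  also have "\<dots> = ennreal (- 0 - - F q)"
    using DERIV_minus[OF D] tendsto_minus[OF lim]
    by (intro nn_integral_FTC_atLeast[where F="\<lambda>x. - F x"]) auto
  finally show "(\<integral>\<^sup>+x. ennreal ((x - q) * \<phi> x * indicator {q..} x) \<partial>lborel) = ennreal (\<phi> q - q * (1 - Phi q))"
    by (simp add: F_def)
qed (auto split: split_indicator)

text \<open>The odds of the largest order statistic are not integrable, so the extreme ranks need a bound of
  first order: above \<open>q\<close> the density is at most \<open>n\<close> times the Gaussian one and Mills' ratio applies,
  below \<open>q\<close> only the inverse odds enter.\<close>

lemma order_stat_bias_max:
  assumes "2 \<le> n"
  shows "\<bar>(\<integral>x. order_stat n n x \<partial>gauss_vec n) - Phi_inv (real n / real (n + 1))\<bar> \<le> sqrt (pi / 2)"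
proof -
  have i: "n \<in> {1..n}" using assms by auto
  define q where "q = Phi_inv (real n / real (n + 1))"
  note odds = Phi_inv_odds[OF i, folded q_def]
  have [simp]: "integrable lborel (\<lambda>x. order_stat_density n n x * (x - q))"
    and eq: "(\<integral>x. order_stat n n x \<partial>gauss_vec n) - q = (\<integral>x. order_stat_density n n x * (x - q) \<partial>lborel)"
  proof -
    interpret prob_space "gauss_vec n" by (rule prob_space_gauss_vec)
    note int = integrable_order_stat[OF i]
    then have "integrable (gauss_vec n) (\<lambda>x. order_stat n n x - q)" by simp
    then show "integrable lborel (\<lambda>x. order_stat_density n n x * (x - q))"
      by (subst (asm) integrable_order_stat_iff[OF i, of "\<lambda>x. x - q"]) auto
    show "(\<integral>x. order_stat n n x \<partial>gauss_vec n) - q = (\<integral>x. order_stat_density n n x * (x - q) \<partial>lborel)"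
      using int integral_order_stat[OF i, of "\<lambda>x. x - q"] by (simp add: prob_space)
  qed
  have "(\<integral>x. order_stat_density n n x * (x - q) \<partial>lborel) \<le> (\<integral>x. real n * ((x - q) * \<phi> x * indicator {q..} x) \<partial>lborel)"
  proof (rule integral_mono)
    show "integrable lborel (\<lambda>x. real n * ((x - q) * \<phi> x * indicator {q..} x))"
      using has_bochner_integral_gaussian_excess[of q] by (simp add: has_bochner_integral_iff)
    fix x
    show "order_stat_density n n x * (x - q) \<le> real n * ((x - q) * \<phi> x * indicator {q..} x)"
    proof (cases "q \<le> x")
      case True
      have "Phi x ^ (n - 1) \<le> 1"
        using Phi_pos[of x] Phi_less_1[of x] by (intro power_le_one) auto
      then have "Phi x ^ (n - 1) * (real n * \<phi> x * (x - q)) \<le> 1 * (real n * \<phi> x * (x - q))"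
        using True by (intro mult_right_mono) auto
      with True show ?thesis by (simp add: order_stat_density_def mult_ac)
    next
      case False
      then show ?thesis using order_stat_density_nonneg[of n n x] by (simp add: mult_nonneg_nonpos)
    qed
  qed simp
  also have "\<dots> = real n * (\<phi> q - q * (1 - Phi q))"
    using has_bochner_integral_gaussian_excess[of q] by (simp add: has_bochner_integral_iff)
  also have "\<dots> \<le> real n * (sqrt (pi / 2) * (1 - Phi q))"
  proof (intro mult_left_mono)
    \<comment> \<open>Needed for Mills' ratio; it holds since \<open>Phi q = n / (n + 1)\<close> is
      at least \<open>1 / 2 = Phi 0\<close>.\<close>
    have "0 \<le> q"
    proof (rule ccontr)
      assume "\<not> 0 \<le> q"
      then have "Phi q < Phi 0" by (intro strict_mono_Phi) simp
      with Phi_uminus[of 0] have "Phi q < 1 / 2" by simp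
      with assms show False unfolding odds(1) by (simp add: field_simps)
    qed
    from gaussian_mills_lower[OF this]
    show "\<phi> q - q * (1 - Phi q) \<le> sqrt (pi / 2) * (1 - Phi q)" by (simp add: algebra_simps)
  qed simp
  \<comment> \<open>At rank \<open>n\<close> the tail \<open>1 - Phi q\<close> equals
    \<open>1 / (n + 1)\<close>, so it absorbs the factor \<open>n\<close>.\<close>
  also have "\<dots> \<le> sqrt (pi / 2)"
    unfolding odds(2) by (simp add: field_simps)
  finally have upper: "(\<integral>x. order_stat_density n n x * (x - q) \<partial>lborel) \<le> sqrt (pi / 2)" .
  \<comment> \<open>The factor \<open>n\<close> is the odds at \<open>q\<close> for rank
    \<open>n\<close>.\<close>
  let ?h = "\<lambda>x. sqrt (pi / 2) / 2 * real n * (order_stat_density n n x * ((1 - Phi x) / Phi x))"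
  have h: "has_bochner_integral lborel ?h (sqrt (pi / 2) / 2 * real n * (1 / (real n - 1)))"
    using has_bochner_integral_inverse_odds[of n n] assms
    by (intro has_bochner_integral_mult_right) (auto simp: of_nat_diff)
  have "- (\<integral>x. order_stat_density n n x * (x - q) \<partial>lborel) = (\<integral>x. - (order_stat_density n n x * (x - q)) \<partial>lborel)"
    by simp
  also have "\<dots> \<le> integral\<^sup>L lborel ?h"
  proof (rule integral_mono)
    show "integrable lborel ?h" using h by (simp add: has_bochner_integral_iff)
    fix x
    have "order_stat_density n n x * (q - x) \<le>
        order_stat_density n n x * (sqrt (pi / 2) / 2 * (Phi q / (1 - Phi q)) * ((1 - Phi x) / Phi x))"
      by (intro mult_left_mono diff_le_inverse_odds order_stat_density_nonneg)
    then show "- (order_stat_density n n x * (x - q)) \<le> ?h x"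
      unfolding odds(3) by (simp add: algebra_simps)
  qed simp
  also have "\<dots> = sqrt (pi / 2) * (real n / (2 * (real n - 1)))"
    using h by (simp add: has_bochner_integral_iff)
  \<comment> \<open>The 2 gained from \<open>d \<le> exp d / 2\<close> gives
    \<open>n \<le> 2 * (n - 1)\<close> already for \<open>n = 2\<close>.\<close>
  also have "\<dots> \<le> sqrt (pi / 2) * 1"
    using assms by (intro mult_left_mono) (auto simp: field_simps)
  finally show ?thesis
    using upper unfolding q_def[symmetric] eq by simp
qed

lemma order_stat_bias:
  assumes i: "i \<in> {1..n}"
  shows "((\<integral>x. order_stat n i x \<partial>gauss_vec n) - Phi_inv (real i / real (n + 1)))\<^sup>2
    \<le> pi / 2 * (2 / real i + 2 / real (n + 1 - i))"
proof -
  define \<delta> where "\<delta> i = (\<integral>x. order_stat n i x \<partial>gauss_vec n) - Phi_inv (real i / real (n + 1))" for i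
  have reflect: "\<delta> (n + 1 - i) = - \<delta> i" if "i \<in> {1..n}" for i
  proof -
    have "real (n + 1 - i) / real (n + 1) = 1 - real i / real (n + 1)"
      using that by (simp add: of_nat_diff field_simps)
    then show ?thesis
      using integral_order_stat_reflect[OF that] Phi_inv_one_minus[of "real i / real (n + 1)"] that
      by (simp add: \<delta>_def)
  qed
  have edge: "(\<delta> n)\<^sup>2 \<le> pi / 2"
  proof (cases "n = 1")
    \<comment> \<open>For \<open>n = 1\<close> the single rank is its own reflection, so its bias is
      0.\<close>
    case True
    with reflect[of 1] show ?thesis by simp
  next
    case False
    with i have "\<bar>\<delta> n\<bar>\<^sup>2 \<le> (sqrt (pi / 2))\<^sup>2"
      unfolding \<delta>_def by (intro power_mono order_stat_bias_max) auto
    then show ?thesis by simp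
  qed
  \<comment> \<open>At an extreme rank one of the two denominators is 1.\<close>
  have edge_le: "pi / 2 \<le> pi / 2 * (2 / real i + 2 / real (n + 1 - i))" if "i = 1 \<or> i = n"
  proof -
    have "1 \<le> 2 / real i + 2 / real (n + 1 - i)" using that by auto
    from mult_left_mono[OF this, of "pi / 2"] show ?thesis by simp
  qed
  consider "i = n" | "i = 1" | "2 \<le> i" "i < n" using i by force
  then have "(\<delta> i)\<^sup>2 \<le> pi / 2 * (2 / real i + 2 / real (n + 1 - i))"
  proof cases
    case 1
    with order_trans[OF edge edge_le] show ?thesis by simp
  next
    case 2
    with order_trans[OF edge edge_le] reflect[of 1] i show ?thesis by simp
  next
    case 3
    then show ?thesis unfolding \<delta>_def by (rule order_stat_bias_interior)
  qed
  then show ?thesis by (simp add: \<delta>_def)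
qed

subsection \<open>The variance of the sorted vector\<close>

text \<open>The new term is at most \<open>ln (n + 1) - ln n\<close>, by
  \<open>ln x \<le> x - 1\<close> at \<open>x = n / (n + 1)\<close>.\<close>

lemma sum_inverse_le_ln:
  assumes "1 \<le> n"
  shows "(\<Sum>i=1..n. 1 / real i) \<le> 1 + ln (real n)"
  using assms
proof (induction n rule: dec_induct)
  case (step n)
  have "ln (real n / real (Suc n)) \<le> real n / real (Suc n) - 1"
    using step.hyps by (intro ln_le_minus_one) auto
  then have "1 / real (Suc n) \<le> ln (real (Suc n)) - ln (real n)"
    using step.hyps by (simp add: ln_div field_simps)
  with step.IH show ?case by simp
qed simp

text \<open>The two sums of reciprocals mirror each other, so the rank-wise bounds add up to
  \<open>2 * pi\<close> times a harmonic number.\<close>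

lemma sum_order_stat_bias_square_le:
  assumes "1 \<le> n"
  shows "(\<Sum>i=1..n. ((\<integral>x. order_stat n i x \<partial>gauss_vec n) - Phi_inv (real i / real (n + 1)))\<^sup>2)
    \<le> 3 * pi / 2 * (2 * ln (real n) + 1 / real n + 1)"
proof -
  have "(\<Sum>i=1..n. ((\<integral>x. order_stat n i x \<partial>gauss_vec n) - Phi_inv (real i / real (n + 1)))\<^sup>2)
      \<le> (\<Sum>i=1..n. pi / 2 * (2 / real i + 2 / real (n + 1 - i)))"
    by (intro sum_mono order_stat_bias)
  also have "\<dots> = pi * ((\<Sum>i=1..n. 1 / real i) + (\<Sum>i=1..n. 1 / real (n + 1 - i)))"
    by (simp add: sum.distrib[symmetric] sum_distrib_left algebra_simps)
  also have "(\<Sum>i=1..n. 1 / real (n + 1 - i)) = (\<Sum>i=1..n. 1 / real i)"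
    by (rule sum.reindex_bij_witness[where i="\<lambda>i. n + 1 - i" and j="\<lambda>i. n + 1 - i"]) auto
  also have "pi * ((\<Sum>i=1..n. 1 / real i) + (\<Sum>i=1..n. 1 / real i)) \<le> pi * ((1 + ln (real n)) + (1 + ln (real n)))"
    by (intro mult_left_mono add_mono sum_inverse_le_ln assms) auto
  also have "\<dots> \<le> pi * (3 / 2 * (2 * ln (real n) + 1 / real n + 1))"
  proof (rule mult_left_mono)
    \<comment> \<open>This amounts to \<open>1 / 2 \<le> ln n + 3 / (2 * n)\<close>: for
      \<open>n = 1\<close> the last term suffices, afterwards
      \<open>ln n \<ge> ln 2 \<ge> 1 / 2\<close>.\<close>
    show "(1 + ln (real n)) + (1 + ln (real n)) \<le> 3 / 2 * (2 * ln (real n) + 1 / real n + 1)"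
    proof (cases "n = 1")
      case False
      have "ln (1 / 2 :: real) \<le> 1 / 2 - 1" by (rule ln_le_minus_one) simp
      then have "1 / 2 \<le> ln (2 :: real)" by (simp add: ln_div)
      also have "\<dots> \<le> ln (real n)" using assms False by simp
      finally have "1 / 2 \<le> ln (real n)" .
      moreover have "0 \<le> 1 / real n" by simp
      ultimately show ?thesis by argo
    qed simp
  qed simp
  also have "\<dots> = 3 * pi / 2 * (2 * ln (real n) + 1 / real n + 1)" by simp
  finally show ?thesis .
qed

text \<open>Each summand is a second moment minus a squared mean, and the second moments add up to
  \<open>n\<close> because sorting preserves the sum of squares.\<close>

lemma sorted_var_eq:
  "sorted_var n = real n - (\<Sum>i=1..n. (\<integral>x. order_stat n i x \<partial>gauss_vec n)\<^sup>2)"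
proof -
  interpret prob_space "gauss_vec n" by (rule prob_space_gauss_vec)
  have "sorted_var n = (\<Sum>i=1..n. expectation (\<lambda>x. (order_stat n i x)\<^sup>2) - (expectation (order_stat n i))\<^sup>2)"
    unfolding sorted_var_def
    by (intro sum.cong refl variance_eq integrable_order_stat integrable_order_stat_square)
  then show ?thesis
    by (simp only: sum_subtractf sum_integral_order_stat_square)
qed

text \<open>Write \<open>q^2 - m^2\<close> as \<open>(m - q)^2 - 2 * m * (m - q)\<close> and apply
  Cauchy-Schwarz to the cross term.\<close>

lemma sum_square_perturbation:
  fixes m q :: "'a \<Rightarrow> real"
  shows "\<bar>(\<Sum>i\<in>A. (q i)\<^sup>2) - (\<Sum>i\<in>A. (m i)\<^sup>2)\<bar>
    \<le> 2 * sqrt ((\<Sum>i\<in>A. (m i)\<^sup>2) * (\<Sum>i\<in>A. (m i - q i)\<^sup>2)) + (\<Sum>i\<in>A. (m i - q i)\<^sup>2)"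
proof -
  let ?c = "\<Sum>i\<in>A. m i * (m i - q i)" and ?S = "\<Sum>i\<in>A. (m i - q i)\<^sup>2"
  have "(q i)\<^sup>2 - (m i)\<^sup>2 = (m i - q i)\<^sup>2 - 2 * (m i * (m i - q i))" for i
    by (simp add: power2_eq_square algebra_simps)
  then have "(\<Sum>i\<in>A. (q i)\<^sup>2) - (\<Sum>i\<in>A. (m i)\<^sup>2) = ?S - 2 * ?c"
    by (simp add: sum_subtractf[symmetric] sum_distrib_left)
  moreover have "\<bar>?c\<bar> \<le> sqrt ((\<Sum>i\<in>A. (m i)\<^sup>2) * ?S)"
    by (rule real_le_rsqrt) (simp add: Cauchy_Schwarz_ineq_sum)
  moreover have "0 \<le> ?S" by (simp add: sum_nonneg)
  ultimately show ?thesis by linarith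
qed

theorem theorem8:
  fixes n :: nat
  assumes "n \<ge> 1"
  shows "(\<forall>i\<in>{1..n}.
           \<bar>integral\<^sup>L (gauss_vec n) (order_stat n i) - Phi_inv (real i / real (n + 1))\<bar>
             \<le> sqrt (pi / 2) * sqrt (2 / real i + 2 / real (n + 1 - i)
                  + \<bar>1 / real i - 1 / (2 * real (n + 1 - i))\<bar>\<^sup>2))
       \<and> \<bar>sorted_var n - (real n - (\<Sum>i=1..n. (Phi_inv (real i / real (n + 1)))\<^sup>2))\<bar>
           \<le> 2 * sqrt (18 * real (n + 1) * (3 * pi / 2) * (2 * ln (real n) + 1 / real n + 1))
             + (3 * pi / 2) * (2 * ln (real n) + 1 / real n + 1)"
proof (intro conjI ballI)
  fix i assume i: "i \<in> {1..n}"
  let ?\<delta> = "integral\<^sup>L (gauss_vec n) (order_stat n i) - Phi_inv (real i / real (n + 1))"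
  have "?\<delta>\<^sup>2 \<le> pi / 2 * (2 / real i + 2 / real (n + 1 - i))"
    by (rule order_stat_bias[OF i])
  also have "\<dots> \<le> pi / 2 * (2 / real i + 2 / real (n + 1 - i) + \<bar>1 / real i - 1 / (2 * real (n + 1 - i))\<bar>\<^sup>2)"
    by (intro mult_left_mono) auto
  finally have "\<bar>?\<delta>\<bar> \<le> sqrt (pi / 2 * (2 / real i + 2 / real (n + 1 - i)
      + \<bar>1 / real i - 1 / (2 * real (n + 1 - i))\<bar>\<^sup>2))"
    by (intro real_le_rsqrt) simp
  then show "\<bar>?\<delta>\<bar> \<le> sqrt (pi / 2) * sqrt (2 / real i + 2 / real (n + 1 - i)
      + \<bar>1 / real i - 1 / (2 * real (n + 1 - i))\<bar>\<^sup>2)"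
    by (simp only: real_sqrt_mult)
next
  define m where "m i = integral\<^sup>L (gauss_vec n) (order_stat n i)" for i
  define q where "q i = Phi_inv (real i / real (n + 1))" for i
  define S where "S = (\<Sum>i=1..n. (m i - q i)\<^sup>2)"
  define D where "D = 3 * pi / 2 * (2 * ln (real n) + 1 / real n + 1)"
  have S: "0 \<le> S" "S \<le> D"
    using sum_order_stat_bias_square_le[OF assms] by (auto simp: S_def D_def m_def q_def sum_nonneg)
  have var: "sorted_var n = real n - (\<Sum>i=1..n. (m i)\<^sup>2)"
    unfolding m_def by (rule sorted_var_eq)
  \<comment> \<open>Nonnegativity of the variance bounds the sum of the squared means by
    \<open>n\<close>, hence by \<open>18 * (n + 1)\<close>.\<close>
  have "0 \<le> sorted_var n"
    unfolding sorted_var_def by (intro sum_nonneg Bochner_Integration.integral_nonneg) simp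
  with var have m: "(\<Sum>i=1..n. (m i)\<^sup>2) \<le> 18 * real (n + 1)" by simp
  have "\<bar>sorted_var n - (real n - (\<Sum>i=1..n. (q i)\<^sup>2))\<bar> = \<bar>(\<Sum>i=1..n. (q i)\<^sup>2) - (\<Sum>i=1..n. (m i)\<^sup>2)\<bar>"
    unfolding var by simp
  also have "\<dots> \<le> 2 * sqrt ((\<Sum>i=1..n. (m i)\<^sup>2) * S) + S"
    unfolding S_def by (rule sum_square_perturbation)
  also have "\<dots> \<le> 2 * sqrt (18 * real (n + 1) * D) + D"
    using S m by (intro add_mono mult_left_mono real_sqrt_le_mono mult_mono) auto
  finally show "\<bar>sorted_var n - (real n - (\<Sum>i=1..n. (Phi_inv (real i / real (n + 1)))\<^sup>2))\<bar>
      \<le> 2 * sqrt (18 * real (n + 1) * (3 * pi / 2) * (2 * ln (real n) + 1 / real n + 1))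
        + (3 * pi / 2) * (2 * ln (real n) + 1 / real n + 1)"
    by (simp only: q_def D_def mult.assoc)
qed

end
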